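(* Let $k\ge 2$ and $1\le r\le k$ be integers, let $U$ be a finite nonempty set, and let $f:\{0,\ldots,k\}^U\to\mathbb{R}_{+}$ be submodular in every orthant and $r$-wise monotone. Let $\mathbf{s}$ be the solution produced by the deterministic greedy algorithm on $f$ (for an arbitrary processing order of $U$), and let $\mathbf{o}$ be an optimal solution, i.e. a maximizer of $f$ over $\{0,\ldots,k\}^U$. Then \[(1+r)f(\mathbf{s})\ \ge\ f(\mathbf{o}).\]
   Context: $\mathbb{R}_{+}$ denotes the non-negative reals. For $s,t\in\{0,\ldots,k\}$ define $\mathrm{min}_0(s,t)=0$ if $s\neq 0$, $t\neq 0$ and $s\neq t$, and $\mathrm{min}_0(s,t)=\min(s,t)$ otherwise; define $\mathrm{max}_0(s,t)=0$ if $s\neq 0$, $t\neq 0$ and $s\neq t$, and $\mathrm{max}_0(s,t)=\max(s,t)$ otherwise. Both are applied coordinate-wise to vectors. Vectors in $\{0,\ldots,k\}^U$ are called partial solutions; an orthant is a vector $\mathbf{x}\in\{1,\ldots,k\}^U$. A partial solution $\mathbf{s}$ is in orthant $\mathbf{x}$ if $s_e\in\{0,x_e\}$ for all $e\in U$. $f$ is submodular in every orthant if for any two partial solutions $\mathbf{a},\mathbf{b}$ in a common orthant, $f(\mathbf{a})+f(\mathbf{b})\ge f(\mathrm{min}_0(\mathbf{a},\mathbf{b}))+f(\mathrm{max}_0(\mathbf{a},\mathbf{b}))$. For $e\in U$, $i\in\{1,\ldots,k\}$ and $\mathbf{s}$ with $s_e=0$, let $f_{i,e}(\mathbf{s})=f(\mathbf{s}+i\cdot\mathbf{1}_e)-f(\mathbf{s})$,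 where $\mathbf{1}_e$ is the unit vector of coordinate $e$. $f$ is $r$-wise monotone if $\sum_{i\in I}f_{i,e}(\mathbf{s})\ge 0$ for every $e\in U$, every $\mathbf{s}$ with $s_e=0$, and every $I\subseteq\{1,\ldots,k\}$ with $|I|=r$. Deterministic greedy algorithm: start with $\mathbf{s}=\mathbf{0}$. Process the elements of $U$ one at a time in an arbitrary order; when processing $e$, compute $y_i=f_{i,e}(\mathbf{s})$ for $i=1,\ldots,k$ with respect to the current $\mathbf{s}$, let $q$ be the smallest index with $y_q=\max(y_1,\ldots,y_k)$, and permanently set $s_e\gets q$. After all elements have been processed, return $\mathbf{s}$. *)

theory Defs
  imports Complex_Main "HOL-Library.FuncSet"
begin

definition min0 :: "nat \<Rightarrow> nat \<Rightarrow> nat" where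
  "min0 s t = (if s \<noteq> 0 \<and> t \<noteq> 0 \<and> s \<noteq> t then 0 else min s t)"

definition max0 :: "nat \<Rightarrow> nat \<Rightarrow> nat" where
  "max0 s t = (if s \<noteq> 0 \<and> t \<noteq> 0 \<and> s \<noteq> t then 0 else max s t)"

(* The power {0..k}^U is the extensional function space, so vectors over U that agree on U
   are equal and coordinatewise operations are restricted to U. *)

definition vmin0 :: "'a set \<Rightarrow> ('a \<Rightarrow> nat) \<Rightarrow> ('a \<Rightarrow> nat) \<Rightarrow> 'a \<Rightarrow> nat" where
  "vmin0 U a b = (\<lambda>e\<in>U. min0 (a e) (b e))"

definition vmax0 :: "'a set \<Rightarrow> ('a \<Rightarrow> nat) \<Rightarrow> ('a \<Rightarrow> nat) \<Rightarrow> 'a \<Rightarrow> nat" where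
  "vmax0 U a b = (\<lambda>e\<in>U. max0 (a e) (b e))"

definition partial_solutions :: "'a set \<Rightarrow> nat \<Rightarrow> ('a \<Rightarrow> nat) set" where
  "partial_solutions U k = (U \<rightarrow>\<^sub>E {0..k})"

definition orthants :: "'a set \<Rightarrow> nat \<Rightarrow> ('a \<Rightarrow> nat) set" where
  "orthants U k = (U \<rightarrow>\<^sub>E {1..k})"

definition in_orthant :: "'a set \<Rightarrow> ('a \<Rightarrow> nat) \<Rightarrow> ('a \<Rightarrow> nat) \<Rightarrow> bool" where
  "in_orthant U s x \<longleftrightarrow> (\<forall>e\<in>U. s e \<in> {0, x e})"

definition submodular_in_every_orthant ::
  "'a set \<Rightarrow> nat \<Rightarrow> (('a \<Rightarrow> nat) \<Rightarrow> real) \<Rightarrow> bool" where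
  "submodular_in_every_orthant U k f \<longleftrightarrow>
     (\<forall>x\<in>orthants U k. \<forall>a\<in>partial_solutions U k. \<forall>b\<in>partial_solutions U k.
        in_orthant U a x \<longrightarrow> in_orthant U b x \<longrightarrow>
        f a + f b \<ge> f (vmin0 U a b) + f (vmax0 U a b))"

(* For e in U, the updated vector is s + i * 1_e; only used where s e = 0. *)
definition marginal :: "(('a \<Rightarrow> nat) \<Rightarrow> real) \<Rightarrow> nat \<Rightarrow> 'a \<Rightarrow> ('a \<Rightarrow> nat) \<Rightarrow> real" where
  "marginal f i e s = f (s(e := s e + i)) - f s"

definition r_wise_monotone ::
  "'a set \<Rightarrow> nat \<Rightarrow> nat \<Rightarrow> (('a \<Rightarrow> nat) \<Rightarrow> real) \<Rightarrow> bool" where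
  "r_wise_monotone U k r f \<longleftrightarrow>
     (\<forall>e\<in>U. \<forall>s\<in>partial_solutions U k. s e = 0 \<longrightarrow>
        (\<forall>I. I \<subseteq> {1..k} \<and> card I = r \<longrightarrow> (\<Sum>i\<in>I. marginal f i e s) \<ge> 0))"

definition greedy_choice ::
  "nat \<Rightarrow> (('a \<Rightarrow> nat) \<Rightarrow> real) \<Rightarrow> 'a \<Rightarrow> ('a \<Rightarrow> nat) \<Rightarrow> nat" where
  "greedy_choice k f e s =
     (LEAST q. q \<in> {1..k} \<and> marginal f q e s = Max ((\<lambda>i. marginal f i e s) ` {1..k}))"

definition greedy_step ::
  "nat \<Rightarrow> (('a \<Rightarrow> nat) \<Rightarrow> real) \<Rightarrow> 'a \<Rightarrow> ('a \<Rightarrow> nat) \<Rightarrow> 'a \<Rightarrow> nat" where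
  "greedy_step k f e s = s(e := greedy_choice k f e s)"

(* The list gives the processing order; the head is processed first. *)
definition greedy ::
  "'a set \<Rightarrow> nat \<Rightarrow> (('a \<Rightarrow> nat) \<Rightarrow> real) \<Rightarrow> 'a list \<Rightarrow> 'a \<Rightarrow> nat" where
  "greedy U k f es = fold (greedy_step k f) es (\<lambda>e\<in>U. 0)"

end

theory Submission
  imports Defs
begin

text \<open>
  Run the greedy algorithm on \<open>s\<close> and simultaneously overwrite the coordinates of a solution \<open>v\<close>,
  initially optimal, by the greedy choices. When \<open>e\<close> is processed, put \<open>t = v(e := 0)\<close>,
  \<open>p = v e\<close> and let \<open>q\<close> be the greedy choice. Since \<open>s\<close> and \<open>t\<close> differ only where \<open>s\<close> vanishes,
  submodularity bounds every marginal at \<open>t\<close> by the marginal at \<open>s\<close>, hence by the gain \<open>y\<close> of the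
  greedy step. The loss of \<open>v\<close> is the difference of the marginals of \<open>p\<close> and \<open>q\<close> at \<open>t\<close>; summing
  the marginals over an \<open>r\<close>-element set containing \<open>q\<close> (and \<open>p\<close>, if \<open>r \<ge> 2\<close>) shows that the loss
  is at most \<open>r * y\<close>. Both processes end in the same vector, so the total loss is at most \<open>r\<close>
  times the total gain.
\<close>

lemma partial_solutions_upd:
  assumes "s \<in> partial_solutions U k" "e \<in> U" "i \<le> k"
  shows "s(e := i) \<in> partial_solutions U k"
  using assms unfolding partial_solutions_def by (auto simp: PiE_iff extensional_def)

lemma marginal_zero: "s e = 0 \<Longrightarrow> marginal f i e s = f (s(e := i)) - f s"
  by (simp add: marginal_def)

text \<open>Orthant submodularity for the pair \<open>s(e := i)\<close>, \<open>t\<close>: the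
  coordinatewise minimum is \<open>s\<close> and the maximum is \<open>t(e := i)\<close>.\<close>

lemma marginal_antimono:
  assumes sub: "submodular_in_every_orthant U k f"
    and s: "s \<in> partial_solutions U k" and t: "t \<in> partial_solutions U k"
    and le: "\<And>u. u \<in> U \<Longrightarrow> s u \<in> {0, t u}"
    and e: "e \<in> U" "s e = 0" "t e = 0" and i: "i \<in> {1..k}"
  shows "marginal f i e t \<le> marginal f i e s"
proof -
  \<comment> \<open>An orthant containing both vectors. It must be nonzero everywhere, so
    coordinates outside \<open>e\<close> where \<open>t\<close> vanishes get the arbitrary value
    1.\<close>
  define x where "x = (\<lambda>u\<in>U. if u = e then i else if t u = 0 then 1 else t u)"
  let ?a = "s(e := i)"
  have tk: "t u \<le> k" if "u \<in> U" for u
    using t that by (auto simp: partial_solutions_def PiE_iff)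
  have ext: "s u = undefined" "t u = undefined" if "u \<notin> U" for u
    using s t that by (auto simp: partial_solutions_def PiE_iff extensional_def)
  have x: "x \<in> orthants U k"
    using i tk by (auto simp: orthants_def x_def Suc_le_eq)
  have a: "?a \<in> partial_solutions U k"
    using s e i by (intro partial_solutions_upd) auto
  have in_x: "in_orthant U ?a x" "in_orthant U t x"
    using le e by (fastforce simp: in_orthant_def x_def)+
  have mn: "vmin0 U ?a t = s" and mx: "vmax0 U ?a t = t(e := i)"
    using le e ext by (fastforce simp: vmin0_def vmax0_def min0_def max0_def fun_eq_iff)+
  have "f (vmin0 U ?a t) + f (vmax0 U ?a t) \<le> f ?a + f t"
    using sub x a t in_x unfolding submodular_in_every_orthant_def by blast
  then have "f s + f (t(e := i)) \<le> f ?a + f t"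
    unfolding mn mx .
  then show ?thesis
    using e by (simp add: marginal_zero)
qed

lemma greedy_choice_maximal:
  assumes "1 \<le> k"
  shows "greedy_choice k f e s \<in> {1..k}"
    and "i \<in> {1..k} \<Longrightarrow> marginal f i e s \<le> marginal f (greedy_choice k f e s) e s"
proof -
  let ?M = "Max ((\<lambda>i. marginal f i e s) ` {1..k})"
  have "?M \<in> (\<lambda>i. marginal f i e s) ` {1..k}"
    using assms by (intro Max_in) auto
  then obtain q where "q \<in> {1..k} \<and> marginal f q e s = ?M" by auto
  then have *: "greedy_choice k f e s \<in> {1..k} \<and> marginal f (greedy_choice k f e s) e s = ?M"
    unfolding greedy_choice_def by (rule LeastI)
  then show "greedy_choice k f e s \<in> {1..k}" by blast
  show "i \<in> {1..k} \<Longrightarrow> marginal f i e s \<le> marginal f (greedy_choice k f e s) e s"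
    using * by simp
qed

text \<open>Enlarge \<open>J\<close> to an \<open>r\<close>-element subset of \<open>A\<close>; each
  of the \<open>r - card J\<close> added terms is at most \<open>y\<close>.\<close>

lemma sum_nonneg_lower_bound:
  fixes a :: "'b \<Rightarrow> real"
  assumes A: "finite A" "r \<le> card A" "J \<subseteq> A" "card J \<le> r"
    and le: "\<And>i. i \<in> A \<Longrightarrow> a i \<le> y"
    and nonneg: "\<And>I. I \<subseteq> A \<Longrightarrow> card I = r \<Longrightarrow> 0 \<le> sum a I"
  shows "0 \<le> sum a J + real (r - card J) * y"
proof -
  obtain I where I: "J \<subseteq> I" "I \<subseteq> A" "card I = r"
    using exists_subset_between[of J r A] A by auto
  have fin: "finite I" "finite J"
    using A I by (auto intro: finite_subset)
  have "0 \<le> sum a I" using nonneg I by blast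
  also have "\<dots> = sum a J + sum a (I - J)"
    using sum.subset_diff[OF I(1) fin(1), of a] by simp
  also have "sum a (I - J) \<le> real (card (I - J)) * y"
    using le I by (intro sum_bounded_above) auto
  also have "card (I - J) = r - card J"
    using I fin by (simp add: card_Diff_subset)
  finally show ?thesis by simp
qed

text \<open>Here \<open>a\<close> stands for the marginals at \<open>t\<close> and \<open>y\<close>
  for the greedy gain. The alternative \<open>a p = 0\<close> covers an optimal solution that leaves
  the coordinate at 0.\<close>

lemma exchange_loss:
  fixes a :: "'b \<Rightarrow> real"
  assumes A: "finite A" "1 \<le> r" "r \<le> card A" "q \<in> A"
    and le: "\<And>i. i \<in> A \<Longrightarrow> a i \<le> y"
    and nonneg: "\<And>I. I \<subseteq> A \<Longrightarrow> card I = r \<Longrightarrow> 0 \<le> sum a I"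
    and p: "p \<in> A \<or> a p = 0"
  shows "a p - a q \<le> real r * y"
proof -
  have bound: "0 \<le> sum a J + real (r - card J) * y" if "J \<subseteq> A" "card J \<le> r" for J
    using A le nonneg that by (intro sum_nonneg_lower_bound) auto
  \<comment> \<open>The empty set gives \<open>0 \<le> r * y\<close>, and \<open>r\<close> is
    positive.\<close>
  have y: "0 \<le> y"
    using bound[of "{}"] A by (auto simp: zero_le_mult_iff)
  have q: "- a q \<le> (real r - 1) * y"
    using bound[of "{q}"] A by simp
  \<comment> \<open>For \<open>r = 1\<close> the pair \<open>{p, q}\<close> is too large for the
    bound, but then \<open>q\<close> already says that \<open>a q\<close> is nonnegative.\<close>
  consider "a p = 0" | "p = q" | "p \<in> A" "p \<noteq> q" "r = 1" | "p \<in> A" "p \<noteq> q" "2 \<le> r"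
    using p A(2) by linarith
  then show ?thesis
  proof cases
    case 1
    then show ?thesis using q y by (simp add: algebra_simps)
  next
    case 2
    then show ?thesis using y by simp
  next
    case 3
    then show ?thesis using q le[of p] by simp
  next
    case 4
    \<comment> \<open>Hence \<open>a p - a q \<le> 2 * a p + (r - 2) * y\<close>, and
      \<open>a p \<le> y\<close> finishes.\<close>
    then have "0 \<le> a p + a q + (real r - 2) * y"
      using bound[of "{p, q}"] A by simp
    then show ?thesis using le[OF \<open>p \<in> A\<close>] by (simp add: algebra_simps)
  qed
qed

lemma greedy_step_loss:
  assumes r: "1 \<le> r" "r \<le> k"
    and sub: "submodular_in_every_orthant U k f" and mono: "r_wise_monotone U k r f"
    and s: "s \<in> partial_solutions U k" and v: "v \<in> partial_solutions U k"
    and e: "e \<in> U" "s e = 0" and le: "\<And>u. u \<in> U \<Longrightarrow> s u \<in> {0, v u}"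
  defines "q \<equiv> greedy_choice k f e s"
  shows "f v - f (v(e := q)) \<le> real r * (f (s(e := q)) - f s)"
proof -
  \<comment> \<open>Clearing \<open>e\<close> gives \<open>v\<close> and \<open>v(e := q)\<close> a
    common base, so that \<open>f t\<close> cancels in the difference of marginals.\<close>
  define t where "t = v(e := 0)"
  have t: "t \<in> partial_solutions U k"
    unfolding t_def using v e by (intro partial_solutions_upd) auto
  have te: "t e = 0" by (simp add: t_def)
  have q: "q \<in> {1..k}" "\<And>i. i \<in> {1..k} \<Longrightarrow> marginal f i e s \<le> marginal f q e s"
    unfolding q_def using greedy_choice_maximal[of k] r by simp_all
  have "marginal f (v e) e t - marginal f q e t \<le> real r * marginal f q e s"
  proof (rule exchange_loss[where A = "{1..k}"])
    fix i assume i: "i \<in> {1..k}"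
    have "s u \<in> {0, t u}" if "u \<in> U" for u
      using le[OF that] e by (auto simp: t_def)
    then have "marginal f i e t \<le> marginal f i e s"
      using sub s t e te i by (intro marginal_antimono) auto
    then show "marginal f i e t \<le> marginal f q e s"
      using q(2)[OF i] by simp
  next
    fix I :: "nat set" assume "I \<subseteq> {1..k}" "card I = r"
    then show "0 \<le> (\<Sum>i\<in>I. marginal f i e t)"
      using mono e t te unfolding r_wise_monotone_def by blast
  next
    have "v e \<le> k"
      using v e by (auto simp: partial_solutions_def PiE_iff)
    then show "v e \<in> {1..k} \<or> marginal f (v e) e t = 0"
      by (cases "v e = 0") (auto simp: marginal_def)
  qed (use r q in auto)
  then show ?thesis
    using e te by (simp add: marginal_zero t_def)
qed

text \<open>The invariant is that \<open>s\<close> vanishes on the unprocessed elements and agrees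
  with \<open>v\<close> on the others. Both vectors vary in the induction, and the losses and gains
  telescope.\<close>

lemma fold_greedy_loss:
  assumes r: "1 \<le> r" "r \<le> k"
    and sub: "submodular_in_every_orthant U k f" and mono: "r_wise_monotone U k r f"
    and "distinct es" "set es \<subseteq> U"
    and "s \<in> partial_solutions U k" "v \<in> partial_solutions U k"
    and "\<And>u. u \<in> set es \<Longrightarrow> s u = 0" "\<And>u. u \<in> U - set es \<Longrightarrow> s u = v u"
  shows "f v - f (fold (greedy_step k f) es s) \<le> real r * (f (fold (greedy_step k f) es s) - f s)"
  using assms(5-)
proof (induction es arbitrary: s v)
  case Nil
  then have "s = v"
    by (intro PiE_ext[of s U "\<lambda>_. {0..k}" v]) (auto simp: partial_solutions_def)
  then show ?case by simp
next
  case (Cons e es)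
  define q where "q = greedy_choice k f e s"
  have q: "q \<le> k"
    unfolding q_def using greedy_choice_maximal(1)[of k f e s] r by auto
  let ?z = "fold (greedy_step k f) es (s(e := q))"
  have "f (v(e := q)) - f ?z \<le> real r * (f ?z - f (s(e := q)))"
  proof (rule Cons.IH)
    show "s(e := q) \<in> partial_solutions U k" "v(e := q) \<in> partial_solutions U k"
      using Cons.prems q by (simp_all add: partial_solutions_upd del: fun_upd_apply)
  qed (use Cons.prems in auto)
  moreover have "f v - f (v(e := q)) \<le> real r * (f (s(e := q)) - f s)"
    unfolding q_def
  proof (rule greedy_step_loss[OF r sub mono])
    show "s u \<in> {0, v u}" if "u \<in> U" for u
      using Cons.prems(5,6) that by (cases "u \<in> set (e # es)") auto
  qed (use Cons.prems in auto)
  moreover have "fold (greedy_step k f) (e # es) s = ?z"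
    by (simp only: fold_simps greedy_step_def[of k f e s] q_def)
  ultimately show ?case
    by (simp add: algebra_simps del: fold_simps)
qed

theorem theorem15:
  fixes k r :: nat
    and U :: "'a set"
    and f :: "('a \<Rightarrow> nat) \<Rightarrow> real"
    and es :: "'a list"
    and opt :: "'a \<Rightarrow> nat"
  assumes "k \<ge> 2"
    and "1 \<le> r" and "r \<le> k"
    and "finite U" and "U \<noteq> {}"
    and "\<forall>s\<in>partial_solutions U k. f s \<ge> 0"
    and "submodular_in_every_orthant U k f"
    and "r_wise_monotone U k r f"
    and "distinct es" and "set es = U"
    and "is_arg_max f (\<lambda>s. s \<in> partial_solutions U k) opt"
  shows "(1 + real r) * f (greedy U k f es) \<ge> f opt"
proof -
  let ?z = "(\<lambda>e\<in>U. 0) :: 'a \<Rightarrow> nat"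
  have z: "?z \<in> partial_solutions U k"
    by (simp add: partial_solutions_def)
  have opt: "opt \<in> partial_solutions U k"
    using assms(11) by (simp add: is_arg_max_def)
  have "f opt - f (greedy U k f es) \<le> real r * (f (greedy U k f es) - f ?z)"
    unfolding greedy_def
  proof (rule fold_greedy_loss[OF assms(2,3,7,8,9) _ z opt])
    show "?z u = 0" if "u \<in> set es" for u
      using that assms(10) by simp
  qed (use assms(10) in auto)
  \<comment> \<open>Nonnegativity of \<open>f\<close> at the zero vector allows its term to be
    dropped.\<close>
  also have "\<dots> \<le> real r * f (greedy U k f es)"
    using assms(6) z by (intro mult_left_mono) auto
  finally show ?thesis
    by (simp add: algebra_simps)
qed

end
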